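(* Let $G_1=K_3$ with vertices $x_1,y,z$. For $i\ge 2$, let $G_i$ be obtained from $G_{i-1}$ by adding a new vertex $x_i$ adjacent to exactly two vertices of $G_{i-1}$, these two being adjacent in $G_{i-1}$ (so that a new triangle is formed), in such a way that $G_i$ is a $2$-connected plane graph whose bounded faces are all triangles. Then $sn(G_i)=2$ for every $i\ge 1$.
   Context: Graphs are finite, undirected and simple. Let $G=(V,E)$ be a connected graph with chromatic number $\chi(G)=k\ge 2$. For $S\subset V$, a partial coloring on $G[S]$ is a proper coloring $\mathscr C_0$ of the induced subgraph $G[S]$ with colors from $\{1,\dots,k\}$ (not all colors need be used). It is a Sudoku coloring of $G$ if there is exactly one proper $k$-coloring $V\to\{1,\dots,k\}$ of $G$ whose restriction to $S$ is $\mathscr C_0$. The Sudoku number $sn(G)$ is the smallest $|S|$ such that $G[S]$ admits a Sudoku coloring of $G$. *)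

theory Defs
  imports "HOL-Analysis.Analysis" "HOL-Library.FuncSet"
begin

section \<open>Graphs and colorings\<close>

text \<open>A finite simple graph is a finite vertex set together with a set of two-element subsets of
  it. The graphs occurring below are finite and simple by construction.\<close>

record 'a graph =
  verts :: "'a set"
  edges :: "'a set set"

definition complete_graph :: "'a set \<Rightarrow> 'a graph" where
  "complete_graph V = \<lparr>verts = V, edges = {e. e \<subseteq> V \<and> card e = 2}\<rparr>"

definition induced_subgraph :: "'a graph \<Rightarrow> 'a set \<Rightarrow> 'a graph" where
  "induced_subgraph G S = \<lparr>verts = S, edges = {e \<in> edges G. e \<subseteq> S}\<rparr>"

definition graph_connected :: "'a graph \<Rightarrow> bool" where
  "graph_connected G \<longleftrightarrow>
     verts G \<noteq> {} \<and>
     (\<forall>u\<in>verts G. \<forall>v\<in>verts G. (u, v) \<in> {(a, b). {a, b} \<in> edges G}\<^sup>*)"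

definition two_connected :: "'a graph \<Rightarrow> bool" where
  "two_connected G \<longleftrightarrow>
     card (verts G) > 2 \<and> graph_connected G \<and>
     (\<forall>v\<in>verts G. graph_connected (induced_subgraph G (verts G - {v})))"

text \<open>Colorings are extensional functions, so that the unique existence in
  \<open>sudoku_coloring\<close> is about maps on the vertex set and not about their junk values.\<close>

definition proper_coloring :: "'a graph \<Rightarrow> nat \<Rightarrow> ('a \<Rightarrow> nat) \<Rightarrow> bool" where
  "proper_coloring G k c \<longleftrightarrow>
     c \<in> verts G \<rightarrow>\<^sub>E {1..k} \<and> (\<forall>u v. {u, v} \<in> edges G \<longrightarrow> c u \<noteq> c v)"

definition chromatic_number :: "'a graph \<Rightarrow> nat" where
  "chromatic_number G = (LEAST k. \<exists>c. proper_coloring G k c)"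

definition sudoku_coloring :: "'a graph \<Rightarrow> 'a set \<Rightarrow> ('a \<Rightarrow> nat) \<Rightarrow> bool" where
  "sudoku_coloring G S c0 \<longleftrightarrow>
     proper_coloring (induced_subgraph G S) (chromatic_number G) c0 \<and>
     (\<exists>!c. proper_coloring G (chromatic_number G) c \<and> restrict c S = c0)"

definition sudoku_number :: "'a graph \<Rightarrow> nat" where
  "sudoku_number G =
     (LEAST n. \<exists>S c0. S \<subseteq> verts G \<and> card S = n \<and> sudoku_coloring G S c0)"

section \<open>Plane graphs\<close>

text \<open>In a drawing, \<open>pos\<close> places the vertices and \<open>curve e\<close> parametrizes the edge \<open>e\<close>. The interior
  of an edge meets neither a vertex nor another edge.\<close>

definition plane_drawing ::
    "'a graph \<Rightarrow> ('a \<Rightarrow> real^2) \<Rightarrow> ('a set \<Rightarrow> real \<Rightarrow> real^2) \<Rightarrow> bool" where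
  "plane_drawing G pos curve \<longleftrightarrow>
     inj_on pos (verts G) \<and>
     (\<forall>e\<in>edges G.
        arc (curve e) \<and> {pathstart (curve e), pathfinish (curve e)} = pos ` e \<and>
        (path_image (curve e) - pos ` e) \<inter> pos ` verts G = {} \<and>
        (\<forall>f\<in>edges G. f \<noteq> e \<longrightarrow>
           (path_image (curve e) - pos ` e) \<inter> path_image (curve f) = {}))"

definition drawing_points ::
    "'a graph \<Rightarrow> ('a \<Rightarrow> real^2) \<Rightarrow> ('a set \<Rightarrow> real \<Rightarrow> real^2) \<Rightarrow> (real^2) set" where
  "drawing_points G pos curve = pos ` verts G \<union> (\<Union>e\<in>edges G. path_image (curve e))"

definition faces ::
    "'a graph \<Rightarrow> ('a \<Rightarrow> real^2) \<Rightarrow> ('a set \<Rightarrow> real \<Rightarrow> real^2) \<Rightarrow> (real^2) set set" where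
  "faces G pos curve = components (- drawing_points G pos curve)"

text \<open>The three vertices are automatically distinct when all edges have two elements.\<close>

definition triangular_face ::
    "'a graph \<Rightarrow> ('a set \<Rightarrow> real \<Rightarrow> real^2) \<Rightarrow> (real^2) set \<Rightarrow> bool" where
  "triangular_face G curve F \<longleftrightarrow>
     (\<exists>a b c. {a, b} \<in> edges G \<and> {b, c} \<in> edges G \<and> {a, c} \<in> edges G \<and>
        frontier F = path_image (curve {a, b}) \<union> path_image (curve {b, c})
                       \<union> path_image (curve {a, c}))"

definition two_connected_plane_triangulated :: "'a graph \<Rightarrow> bool" where
  "two_connected_plane_triangulated G \<longleftrightarrow>
     two_connected G \<and>
     (\<exists>pos curve. plane_drawing G pos curve \<and>
        (\<forall>F\<in>faces G pos curve. bounded F \<longrightarrow> triangular_face G curve F))"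

definition add_vertex :: "'a graph \<Rightarrow> 'a \<Rightarrow> 'a set \<Rightarrow> 'a graph" where
  "add_vertex G x N =
     \<lparr>verts = insert x (verts G), edges = edges G \<union> {{x, w} | w. w \<in> N}\<rparr>"

end

theory Submission
  imports Defs "HOL-Combinatorics.Transposition"
begin

text \<open>In a graph built from a triangle by attaching vertices to edges, the colours of two adjacent
  vertices force all others in a 3-coloring, so two clues suffice. Conversely, with at most
  \<open>\<chi>(G) - 2\<close> clues, two colours are missing among the clues and exchanging them gives a second
  coloring; it is really different, because a \<open>\<chi>(G)\<close>-coloring uses every colour.\<close>

section \<open>Recoloring, missing colours, and the general lower bound\<close>

lemma edges_complete_graph_pair:
  "{u, v} \<in> edges (complete_graph V) \<longleftrightarrow> u \<in> V \<and> v \<in> V \<and> u \<noteq> v"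
  by (auto simp: complete_graph_def card_2_iff doubleton_eq_iff)

text \<open>Injectivity on the colours in use is enough to keep adjacent vertices apart. This covers
  both applications: moving one colour into a gap and exchanging two colours.\<close>

lemma proper_coloring_relabel:
  assumes c: "proper_coloring G k c"
    and edges: "\<And>e. e \<in> edges G \<Longrightarrow> e \<subseteq> verts G"
    and maps: "\<And>v. v \<in> verts G \<Longrightarrow> p (c v) \<in> {1..l}"
    and inj: "inj_on p (c ` verts G)"
  shows "proper_coloring G l (restrict (p \<circ> c) (verts G))"
  unfolding proper_coloring_def
proof (intro conjI allI impI)
  show "restrict (p \<circ> c) (verts G) \<in> verts G \<rightarrow>\<^sub>E {1..l}"
    using maps by auto
next
  fix u v assume uv: "{u, v} \<in> edges G"
  then have "u \<in> verts G" "v \<in> verts G" "c u \<noteq> c v"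
    using edges[OF uv] c by (auto simp: proper_coloring_def)
  then show "restrict (p \<circ> c) (verts G) u \<noteq> restrict (p \<circ> c) (verts G) v"
    using inj by (auto dest: inj_onD)
qed

text \<open>If the colour \<open>j\<close> were missing, the vertices of the last colour could take
  it, leaving a proper coloring with one colour fewer and contradicting minimality.\<close>

lemma chromatic_number_coloring_surj:
  assumes c: "proper_coloring G (chromatic_number G) c"
    and edges: "\<And>e. e \<in> edges G \<Longrightarrow> e \<subseteq> verts G"
    and j: "j \<in> {1..chromatic_number G}"
  shows "j \<in> c ` verts G"
proof (rule ccontr)
  assume miss: "j \<notin> c ` verts G"
  define k where "k = chromatic_number G"
  \<comment> \<open>For \<open>j = k\<close> this is the identity; then \<open>k\<close> itself is
    the missing colour and all colours in use are at most \<open>k - 1\<close> already.\<close>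
  define p where "p = (\<lambda>a. if a = k then j else a)"
  have "p (c v) \<in> {1..k - 1}" if v: "v \<in> verts G" for v
  proof -
    have "c v \<in> {1..k}" "c v \<noteq> j"
      using c v miss by (auto simp: proper_coloring_def k_def)
    then show ?thesis using j by (auto simp: p_def k_def)
  qed
  moreover have "inj_on p (c ` verts G)"
    using miss by (auto simp: inj_on_def p_def)
  ultimately have "\<exists>d. proper_coloring G (k - 1) d"
    using proper_coloring_relabel[OF c edges] by blast
  then have "k \<le> k - 1"
    unfolding k_def chromatic_number_def by (rule Least_le)
  \<comment> \<open>Subtraction truncates at 0, so \<open>k <= k - 1\<close> is absurd only for
    positive \<open>k\<close>, which \<open>j\<close> in \<open>{1..k}\<close> provides.\<close>
  then show False using j by (simp add: k_def)
qed

lemma chromatic_number_le_Suc_card_sudoku: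
  assumes sud: "sudoku_coloring G S c0" and S: "S \<subseteq> verts G" "finite S"
    and edges: "\<And>e. e \<in> edges G \<Longrightarrow> e \<subseteq> verts G"
  shows "chromatic_number G \<le> Suc (card S)"
proof (rule ccontr)
  assume "\<not> ?thesis"
  then have big: "card S + 2 \<le> chromatic_number G" by simp
  define k where "k = chromatic_number G"
  obtain c where c: "proper_coloring G k c" "restrict c S = c0"
    and uniq: "\<And>d. proper_coloring G k d \<Longrightarrow> restrict d S = c0 \<Longrightarrow> d = c"
    using sud unfolding sudoku_coloring_def k_def by blast
  \<comment> \<open>The clues use at most \<open>card S\<close> colours; the two colours to be
    exchanged come from the remaining ones.\<close>
  have "k - card S \<le> card ({1..k} - c ` S)"
    using diff_card_le_card_Diff[of "c ` S" "{1..k}"] card_image_le[OF S(2), of c] S(2) by simp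
  then have "2 \<le> card ({1..k} - c ` S)"
    using big by (simp add: k_def)
  then obtain T where "T \<subseteq> {1..k} - c ` S" "card T = 2"
    by (meson obtain_subset_with_card_n)
  then obtain m n where mn: "m \<in> {1..k}" "n \<in> {1..k}" "m \<notin> c ` S" "n \<notin> c ` S" "m \<noteq> n"
    by (auto simp: card_2_iff)
  define d where "d = restrict (Transposition.transpose m n \<circ> c) (verts G)"
  have "proper_coloring G k d"
    unfolding d_def
  proof (rule proper_coloring_relabel[OF c(1) edges])
    fix v assume "v \<in> verts G"
    then have "c v \<in> {1..k}" using c(1) by (auto simp: proper_coloring_def)
    then show "Transposition.transpose m n (c v) \<in> {1..k}"
      using mn(1,2) by (simp add: Transposition.transpose_def)
  qed (auto intro: inj_on_subset[OF inj_transpose])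
  moreover have "restrict d S = c0"
    unfolding c(2)[symmetric]
  proof (rule restrict_ext)
    fix v assume "v \<in> S"
    then have "v \<in> verts G" "c v \<noteq> m" "c v \<noteq> n" using S(1) mn by auto
    then show "d v = c v" by (simp add: d_def Transposition.transpose_def)
  qed
  ultimately have "d = c" by (rule uniq)
  obtain v where v: "v \<in> verts G" "c v = m"
    using chromatic_number_coloring_surj[OF c(1)[unfolded k_def] edges] mn(1)
    unfolding k_def by blast
  then have "d v = n" by (simp add: d_def)
  then show False using \<open>d = c\<close> v mn(5) by simp
qed

section \<open>Graphs grown from a triangle and their 3-colorings\<close>

text \<open>These are the 2-trees of graph theory. The initial triangle is kept as a parameter
  because its vertices \<open>a\<close> and \<open>b\<close> will carry the clues.\<close>

inductive two_tree :: "'a \<Rightarrow> 'a \<Rightarrow> 'a \<Rightarrow> 'a graph \<Rightarrow> bool" for a b c where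
  triangle: "distinct [a, b, c] \<Longrightarrow> two_tree a b c (complete_graph {a, b, c})"
| attach: "two_tree a b c H \<Longrightarrow> v \<notin> verts H \<Longrightarrow> {u, w} \<in> edges H \<Longrightarrow>
    two_tree a b c (add_vertex H v {u, w})"

lemma two_tree_edges_subset:
  "two_tree a b c H \<Longrightarrow> e \<in> edges H \<Longrightarrow> e \<subseteq> verts H"
proof (induction arbitrary: e rule: two_tree.induct)
  case (attach H v u w)
  have "{u, w} \<subseteq> verts H" by (rule attach.IH[OF attach.hyps(3)])
  then show ?case using attach.IH attach.prems by (fastforce simp: add_vertex_def)
qed (simp add: complete_graph_def)

lemma two_tree_triangle:
  "two_tree a b c H \<Longrightarrow>
    {a, b} \<in> edges H \<and> {b, c} \<in> edges H \<and> {a, c} \<in> edges H"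
  by (induction rule: two_tree.induct)
    (auto simp: edges_complete_graph_pair add_vertex_def)

lemma proper_coloring_add_vertex_upd:
  assumes f: "proper_coloring H k f" and v: "v \<notin> verts H" and N: "N \<subseteq> verts H"
    and edges: "\<And>e. e \<in> edges H \<Longrightarrow> e \<subseteq> verts H"
    and j: "j \<in> {1..k}" "j \<notin> f ` N"
  shows "proper_coloring (add_vertex H v N) k (f(v := j))"
  unfolding proper_coloring_def
proof (intro conjI allI impI)
  show "f(v := j) \<in> verts (add_vertex H v N) \<rightarrow>\<^sub>E {1..k}"
    using f j by (auto simp: proper_coloring_def add_vertex_def PiE_def extensional_def)
next
  fix s t assume "{s, t} \<in> edges (add_vertex H v N)"
  then consider "{s, t} \<in> edges H" | "s = v" "t \<in> N" | "t = v" "s \<in> N"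
    by (auto simp: add_vertex_def doubleton_eq_iff)
  then show "(f(v := j)) s \<noteq> (f(v := j)) t"
  proof cases
    case 1
    then have "s \<noteq> v" "t \<noteq> v" using edges[OF 1] v by auto
    then show ?thesis using 1 f by (auto simp: proper_coloring_def)
  qed (use v N j(2) in auto)
qed

lemma proper_coloring_add_vertexD:
  assumes f: "proper_coloring (add_vertex H v N) k f"
    and edges: "\<And>e. e \<in> edges H \<Longrightarrow> e \<subseteq> verts H"
  shows "proper_coloring H k (restrict f (verts H))"
  unfolding proper_coloring_def
proof (intro conjI allI impI)
  show "restrict f (verts H) \<in> verts H \<rightarrow>\<^sub>E {1..k}"
    using f by (auto simp: proper_coloring_def add_vertex_def)
next
  fix s t assume st: "{s, t} \<in> edges H"
  then have "f s \<noteq> f t" using f by (auto simp: proper_coloring_def add_vertex_def)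
  then show "restrict f (verts H) s \<noteq> restrict f (verts H) t"
    using edges[OF st] by auto
qed

text \<open>Greedy extension: a new vertex has at most two neighbours, so one of the three colours
  is free for it. Older vertices keep their colours, hence the values at \<open>a\<close> and
  \<open>b\<close> survive the induction.\<close>

lemma two_tree_coloring_exists:
  "two_tree a b c H \<Longrightarrow> \<exists>f. proper_coloring H 3 f \<and> f a = 1 \<and> f b = 2"
proof (induction rule: two_tree.induct)
  case triangle
  let ?f = "\<lambda>v\<in>{a, b, c}. if v = a then 1 else if v = b then 2 else (3::nat)"
  have "verts (complete_graph {a, b, c}) = {a, b, c}" by (simp add: complete_graph_def)
  then have "proper_coloring (complete_graph {a, b, c}) 3 ?f"
    using triangle by (auto simp: proper_coloring_def edges_complete_graph_pair)
  moreover have "?f a = 1" "?f b = 2" using triangle by auto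
  ultimately show ?case by blast
next
  case (attach H v u w)
  then obtain f where f: "proper_coloring H 3 f" "f a = 1" "f b = 2" by blast
  note sub = two_tree_edges_subset[OF attach.hyps(1)]
  have "card (f ` {u, w}) < card {1..3::nat}"
    using card_image_le[of "{u, w}" f] card_insert_le_m1[of 2 "{w}" u] by simp
  then obtain j where j: "j \<in> {1..3}" "j \<notin> f ` {u, w}"
    by (meson card_mono finite.emptyI finite.insertI finite_imageI not_less subsetI)
  have "a \<noteq> v" "b \<noteq> v"
    using two_tree_triangle[OF attach.hyps(1)] sub attach.hyps(2) by blast+
  then have "(f(v := j)) a = 1" "(f(v := j)) b = 2" using f by simp_all
  then show ?case
    using proper_coloring_add_vertex_upd[OF f(1) attach.hyps(2) sub[OF attach.hyps(3)] sub j]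
    by blast
qed

text \<open>This carries colours across a triangle: \<open>p\<close> and \<open>q\<close> will be
  the colours of one vertex in two colorings that agree on the other two vertices.\<close>

lemma third_color_unique:
  fixes i :: nat
  assumes "{i, j, p, q} \<subseteq> {1..3}" "i \<noteq> j" "p \<notin> {i, j}" "q \<notin> {i, j}"
  shows "p = q"
proof -
  have "i = 1 \<or> i = 2 \<or> i = 3" "j = 1 \<or> j = 2 \<or> j = 3"
    "p = 1 \<or> p = 2 \<or> p = 3" "q = 1 \<or> q = 2 \<or> q = 3"
    using assms(1) by auto
  then show ?thesis using assms(2-) by auto
qed

text \<open>The ends of the edge to which a vertex is attached have different colours, equal in
  \<open>f\<close> and \<open>g\<close> by induction, so only one colour is left for the new vertex.
  Equality holds as functions because colorings are extensional.\<close>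

lemma two_tree_coloring_unique:
  assumes "two_tree a b c H" "proper_coloring H 3 f" "proper_coloring H 3 g"
    and "f a = g a" "f b = g b"
  shows "f = g"
  using assms
proof (induction arbitrary: f g rule: two_tree.induct)
  case triangle
  have verts: "verts (complete_graph {a, b, c}) = {a, b, c}" by (simp add: complete_graph_def)
  have fg: "f \<in> {a, b, c} \<rightarrow>\<^sub>E {1..3}" "g \<in> {a, b, c} \<rightarrow>\<^sub>E {1..3}"
    using triangle.prems verts by (auto simp: proper_coloring_def)
  have ne: "f a \<noteq> f b" "f c \<noteq> f a" "f c \<noteq> f b" "g c \<noteq> g a" "g c \<noteq> g b"
    using triangle two_tree_triangle[OF two_tree.triangle[OF triangle.hyps]]
    unfolding proper_coloring_def by metis+
  have "f c = g c"
  proof (rule third_color_unique)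
    show "{f a, f b, f c, g c} \<subseteq> {1..3}" using fg by blast
  qed (use ne triangle.prems(3,4) in simp_all)
  then show ?case
    using fg triangle.prems by (intro PiE_ext[OF fg]) auto
next
  case (attach H v u w)
  note sub = two_tree_edges_subset[OF attach.hyps(1)]
  have ab: "a \<in> verts H" "b \<in> verts H"
    using two_tree_triangle[OF attach.hyps(1)] sub by blast+
  \<comment> \<open>A coloring of the larger graph has to be cut down to \<open>verts H\<close> to
    be extensional there, as the induction hypothesis requires.\<close>
  have "restrict f (verts H) = restrict g (verts H)"
    by (rule attach.IH[OF proper_coloring_add_vertexD[OF attach.prems(1) sub]
          proper_coloring_add_vertexD[OF attach.prems(2) sub]])
      (use attach.prems(3,4) ab in simp_all)
  then have eq: "f t = g t" if "t \<in> verts H" for t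
    using that by (metis restrict_apply')
  have uw: "u \<in> verts H" "w \<in> verts H" using sub[OF attach.hyps(3)] by auto
  have fg: "f \<in> insert v (verts H) \<rightarrow>\<^sub>E {1..3}" "g \<in> insert v (verts H) \<rightarrow>\<^sub>E {1..3}"
    using attach.prems by (auto simp: proper_coloring_def add_vertex_def)
  have edge: "{u, w} \<in> edges (add_vertex H v {u, w})" "{v, u} \<in> edges (add_vertex H v {u, w})"
    "{v, w} \<in> edges (add_vertex H v {u, w})"
    using attach.hyps(3) by (auto simp: add_vertex_def)
  then have ne: "f u \<noteq> f w" "f v \<noteq> f u" "f v \<noteq> f w" "g v \<noteq> g u" "g v \<noteq> g w"
    using attach.prems(1,2) unfolding proper_coloring_def by blast+
  have "f v = g v"
  proof (rule third_color_unique)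
    show "{f u, f w, f v, g v} \<subseteq> {1..3}" using fg uw by blast
  qed (use ne uw eq in simp_all)
  then show ?case
    using eq by (intro PiE_ext[OF fg]) auto
qed

section \<open>Chromatic number and Sudoku number\<close>

text \<open>The greedy coloring gives the upper bound; the initial triangle persists in every later
  graph and forces three colours.\<close>

lemma two_tree_chromatic_number:
  assumes "two_tree a b c H"
  shows "chromatic_number H = 3"
  unfolding chromatic_number_def
proof (rule Least_equality)
  show "\<exists>f. proper_coloring H 3 f" using two_tree_coloring_exists[OF assms] by blast
next
  fix k assume "\<exists>f. proper_coloring H k f"
  then obtain f where f: "proper_coloring H k f" by blast
  have tri: "{a, b} \<in> edges H" "{b, c} \<in> edges H" "{a, c} \<in> edges H"
    using two_tree_triangle[OF assms] by auto
  then have "{a, b, c} \<subseteq> verts H"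
    using two_tree_edges_subset[OF assms] by blast
  then have sub: "{f a, f b, f c} \<subseteq> {1..k}"
    using f by (auto simp: proper_coloring_def)
  have "f a \<noteq> f b" "f b \<noteq> f c" "f a \<noteq> f c"
    using f tri unfolding proper_coloring_def by blast+
  then have "card {f a, f b, f c} = 3" by simp
  then show "3 \<le> k" using card_mono[OF _ sub] by simp
qed

lemma two_tree_sudoku_number:
  assumes H: "two_tree a b c H"
  shows "sudoku_number H = 2"
  unfolding sudoku_number_def
proof (rule Least_equality)
  note sub = two_tree_edges_subset[OF H] and chi = two_tree_chromatic_number[OF H]
  have ab: "{a, b} \<in> edges H" using two_tree_triangle[OF H] by simp
  then have S: "{a, b} \<subseteq> verts H" by (rule sub)
  obtain f where f: "proper_coloring H 3 f" "f a = 1" "f b = 2"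
    using two_tree_coloring_exists[OF H] by blast
  have "a \<noteq> b" using f by auto
  have "sudoku_coloring H {a, b} (restrict f {a, b})"
    unfolding sudoku_coloring_def chi
  proof (intro conjI ex1I[of _ f])
    show "proper_coloring (induced_subgraph H {a, b}) 3 (restrict f {a, b})"
      using f S by (auto simp: proper_coloring_def induced_subgraph_def)
  next
    fix g assume g: "proper_coloring H 3 g \<and> restrict g {a, b} = restrict f {a, b}"
    then have "g a = f a" "g b = f b" by (metis insertCI restrict_apply')+
    then show "g = f" using two_tree_coloring_unique[OF H] g f(1) by blast
  qed (use f in auto)
  then show "\<exists>S c0. S \<subseteq> verts H \<and> card S = 2 \<and> sudoku_coloring H S c0"
    using S \<open>a \<noteq> b\<close> by (intro exI[of _ "{a, b}"] exI) auto
next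
  note sub = two_tree_edges_subset[OF H] and chi = two_tree_chromatic_number[OF H]
  fix n assume "\<exists>S c0. S \<subseteq> verts H \<and> card S = n \<and> sudoku_coloring H S c0"
  then obtain S c0 where S: "S \<subseteq> verts H" "card S = n" "sudoku_coloring H S c0" by blast
  \<comment> \<open>Finiteness comes from the construction. It excludes infinite clue sets, whose
    \<open>card\<close> would be the default value 0.\<close>
  have "finite (verts H)"
    using H by (induction rule: two_tree.induct) (auto simp: complete_graph_def add_vertex_def)
  then have "finite S" using S(1) by (rule rev_finite_subset)
  then show "2 \<le> n"
    using chromatic_number_le_Suc_card_sudoku[OF S(3,1) _ sub] S(2) chi by simp
qed

theorem theorem3p12:
  fixes G :: "nat \<Rightarrow> 'a graph" and x :: "nat \<Rightarrow> 'a" and y z :: 'a and i :: nat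
  assumes i: "i \<ge> 1"
    and distinct_base: "distinct [x 1, y, z]"
    and base: "G 1 = complete_graph {x 1, y, z}"
    and step: "\<And>j. 2 \<le> j \<Longrightarrow> j \<le> i \<Longrightarrow>
        x j \<notin> verts (G (j - 1)) \<and>
        (\<exists>u v. {u, v} \<subseteq> verts (G (j - 1)) \<and> u \<noteq> v \<and> {u, v} \<in> edges (G (j - 1)) \<and>
               G j = add_vertex (G (j - 1)) (x j) {u, v}) \<and>
        two_connected_plane_triangulated (G j)"
  shows "sudoku_number (G i) = 2"
proof -
  \<comment> \<open>The bound \<open>j \<le> i\<close> stays inside the induction claim, since the
    construction of \<open>G j\<close> is assumed only up to \<open>i\<close>.\<close>
  have "j \<le> i \<longrightarrow> two_tree (x 1) y z (G j)" if "1 \<le> j" for j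
    using that
  proof (induction j rule: dec_induct)
    case base
    then show ?case using two_tree.triangle[OF distinct_base] assms(3) by simp
  next
    case (step j)
    show ?case
    proof
      assume "Suc j \<le> i"
      then obtain u v where "x (Suc j) \<notin> verts (G j)" "{u, v} \<in> edges (G j)"
        "G (Suc j) = add_vertex (G j) (x (Suc j)) {u, v}" "two_tree (x 1) y z (G j)"
        using assms(4)[of "Suc j"] step by auto
      then show "two_tree (x 1) y z (G (Suc j))" by (simp add: two_tree.attach)
    qed
  qed
  then have "two_tree (x 1) y z (G i)" using i by blast
  then show ?thesis by (rule two_tree_sudoku_number)
qed

end
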